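(* Let $V\in\mathcal V^*$, let $\bar u$ be any collision solution of $\ddot u=\nabla V(|u|)$ with energy $E$, and let $\bar\nu$ be its initial condition, taken in the normalized form described in the context. For every sufficiently small $\varepsilon>0$ let $u_{\varepsilon,\nu}$ be the solution of the regularized system $\ddot u=\nabla V_\varepsilon(|u|)$ with initial condition $\nu$, and let $\Delta\theta(u_{\varepsilon,\nu})$ be its apsidal angle inside $B_0(\bar R)$. Then there exists $$\lim_{(\varepsilon,\nu)\to(0,\bar\nu)}\Delta\theta(u_{\varepsilon,\nu})$$ and such limit is $\frac{\pi}{2}$.
   Context: **The classes $\mathcal V$ and $\mathcal V^*$.** $\mathcal V$ is the set of functions $V\in C^\infty(\mathbb R^+,\mathbb R)$ such that (i) $\lim_{x\to0^+}V(x)=+\infty$; there exists $S>0$ such that for every $x\in(0,S)$: (ii) $V'(x)<0$ and $V''(x)>0$; (iii) the function $V'(x)/V''(x)$ is decreasing with respect to $x$; and (iv) $\frac{d}{dx}\frac{V'(x)}{V''(x)}(0)<-\frac12$. $\mathcal V^*$ is the set of $V\in\mathcal V$ with the further property (v) $\lim_{\lambda\to0}V(\lambda x)/V(\lambda)=1$ for every $x\ge1$, uniformly on every compact $[1,M]$. Properties (iii), (iv) guarantee the existence of $T_*>0$ with $V'(x)/V''(x)\le -x/2$ in $(0,T_* )$. Put $\bar R:=\min\{T_*,S\}$ (the value $+\infty$ is allowed; for $V(x)=-\log x$ one has $\bar R=+\infty$). $B_0(\bar R)$ is the ball of radius $\bar R$ centered at the origin of $\mathbb R^2$. For $\varepsilon>0$,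 $V_\varepsilon(x)=V(\sqrt{x^2+\varepsilon^2})$. Here $\nabla V(|u|)$ and $\nabla V_\varepsilon(|u|)$ denote gradients with respect to $u\in\mathbb R^2$. **Normalized initial condition of a collision solution.** A collision solution $\bar u$ is a solution ending in the collision $u=0$; for $V\in\mathcal V$ this happens if and only if the angular momentum is zero, and the motion is along a straight line through the origin. Its energy is $E=\frac12|\dot{\bar u}|^2-V(|\bar u|)$. Let $P$ be the first positive solution of $2r^2(E+V(r))=0$ ($P:=+\infty$ if there is none). Case 1, $P<\bar R$: $\bar\nu=(\bar q,0)$ with $|\bar q|=P$. Case 2, $P\ge\bar R$: $\bar\nu=(\bar q,\bar p)$ with $|\bar q|=\bar R$, $|\bar p|^2=2(E+V(\bar R))$, and $\bar p$ directed toward the origin. **Apsidal angle.** For an initial condition $\nu=(q_0,p_0)\in\mathbb R^2\times\mathbb R^2$, let $l=|q_0\wedge p_0|$ be the modulus of the angular momentum, $E_{\varepsilon,\nu}=\frac12|p_0|^2-V_\varepsilon(|q_0|)$ the energy, and $f_{\varepsilon,\nu}(r)=2r^2(E_{\varepsilon,\nu}+V_\varepsilon(r))$. $R_+$ is the minimum positive $r$ with $f_{\varepsilon,\nu}(r)=l^2$ and $f_{\varepsilon,\nu}'(r)<0$ if it exists, $R_+=+\infty$ otherwise; $R_-$ is the minimum positive $r<R_+$ with $f_{\varepsilon,\nu}(r)=l^2$ and $f_{\varepsilon,\nu}'(r)>0$ if it exists, $R_-=0$ otherwise ($R_+$ and $R_-$ are the apocentre and pericentre values of $r=|u_{\varepsilon,\nu}|$).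 With $\beta=\min\{\bar R,R_+\}$, $$\Delta\theta(u_{\varepsilon,\nu})=\int_{R_-}^{\beta}\frac{l}{r^2\,\dot r}\,dr,\qquad \dot r^2=2(E_{\varepsilon,\nu}+V_\varepsilon(r))-\frac{l^2}{r^2},\quad \dot r\ge 0\text{ in the integral},$$ i.e. the angle swept between the pericentre and the apocentre if the trajectory is bounded by $\bar R$, and otherwise the angle covered between the point where the path enters $B_0(\bar R)$ and the point of minimal distance from the origin.
   Formalization: The limit is taken over initial conditions ν with nonzero angular momentum only: for zero angular momentum (for instance ν equal to the collision initial condition itself) the integral defining the apsidal angle is 0, so the unrestricted limit would fail. *)

theory Defs
  imports "HOL-Analysis.Analysis"
begin

section \<open>The classes of potentials\<close>

text \<open>\<open>C\<^sup>\<infinity>\<close> on the open half-line; values of \<open>V\<close> outside \<open>(0,\<infinity>)\<close> are irrelevant throughout.\<close>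

definition smooth_pos :: "(real \<Rightarrow> real) \<Rightarrow> bool" where
  "smooth_pos V \<longleftrightarrow> (\<forall>n. \<forall>x>0. ((deriv ^^ n) V) differentiable (at x))"

definition deriv_ratio :: "(real \<Rightarrow> real) \<Rightarrow> real \<Rightarrow> real" where
  "deriv_ratio V x = deriv V x / deriv (deriv V) x"

text \<open>Conditions (ii) and (iii) on \<open>(0,S)\<close>; the value \<open>S = \<infinity>\<close> is allowed. ``Decreasing'' is
  taken in the weak sense, which gives the larger class.\<close>

definition convexity_radius :: "(real \<Rightarrow> real) \<Rightarrow> ereal \<Rightarrow> bool" where
  "convexity_radius V S \<longleftrightarrow> 0 < S
     \<and> (\<forall>x>0. ereal x < S \<longrightarrow> deriv V x < 0 \<and> deriv (deriv V) x > 0)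
     \<and> (\<forall>x>0. \<forall>y>x. ereal y < S \<longrightarrow> deriv_ratio V y \<le> deriv_ratio V x)"

text \<open>\<open>V'/V''\<close> is not defined at \<open>0\<close>. Its derivative there is the right derivative of its continuous
  extension; \<open>L\<close> is the value of that extension (differentiability forces it to be the
  right limit).\<close>

definition class_V :: "(real \<Rightarrow> real) set" where
  "class_V = {V. smooth_pos V
     \<and> filterlim V at_top (at_right 0)
     \<and> (\<exists>S. convexity_radius V S)
     \<and> (\<exists>L D. ((\<lambda>x. if x = 0 then L else deriv_ratio V x) has_real_derivative D) (at 0 within {0..})
              \<and> D < -1/2)}"

definition class_V_star :: "(real \<Rightarrow> real) set" where
  "class_V_star = {V \<in> class_V.
     \<forall>M\<ge>1. uniform_limit {1..M} (\<lambda>s x. V (s * x) / V s) (\<lambda>_. 1) (at_right 0)}"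

definition ratio_radius :: "(real \<Rightarrow> real) \<Rightarrow> ereal \<Rightarrow> bool" where
  "ratio_radius V T \<longleftrightarrow> 0 < T \<and> (\<forall>x>0. ereal x < T \<longrightarrow> deriv_ratio V x \<le> - x / 2)"

definition V_reg :: "(real \<Rightarrow> real) \<Rightarrow> real \<Rightarrow> real \<Rightarrow> real" where
  "V_reg V \<epsilon> x = V (sqrt (x\<^sup>2 + \<epsilon>\<^sup>2))"


section \<open>Solutions in the plane\<close>

type_synonym phase = "(real^2) \<times> (real^2)"

abbreviation velocity :: "(real \<Rightarrow> real^2) \<Rightarrow> real \<Rightarrow> real^2" where
  "velocity u t \<equiv> vector_derivative u (at t)"

definition is_solution :: "(real \<Rightarrow> real) \<Rightarrow> real set \<Rightarrow> (real \<Rightarrow> real^2) \<Rightarrow> bool" where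
  "is_solution W J u \<longleftrightarrow> (\<forall>t\<in>J. u differentiable (at t)
     \<and> (\<exists>a. (velocity u has_vector_derivative a) (at t)
            \<and> (GDERIV (\<lambda>x. W (norm x)) (u t) :> a)))"

definition initial :: "(real \<Rightarrow> real^2) \<Rightarrow> phase" where
  "initial u = (u 0, velocity u 0)"

text \<open>The initial time is \<open>0\<close> and the collision happens at the right end point \<open>b\<close>. The solution
  is considered on an open interval around \<open>0\<close>, so that \<^const>\<open>initial\<close> makes sense.\<close>

definition collision_solution :: "(real \<Rightarrow> real) \<Rightarrow> (real \<Rightarrow> real^2) \<Rightarrow> bool" where
  "collision_solution V u \<longleftrightarrow> (\<exists>a<0. \<exists>b>0. is_solution V {a<..<b} u
     \<and> (\<forall>t\<in>{a<..<b}. u t \<noteq> 0) \<and> (u \<longlongrightarrow> 0) (at_left b))"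

text \<open>The energy is a constant of motion, hence a function of the initial condition.\<close>

definition energy :: "(real \<Rightarrow> real) \<Rightarrow> phase \<Rightarrow> real" where
  "energy W = (\<lambda>(q, p). (norm p)\<^sup>2 / 2 - W (norm q))"

definition ang_mom :: "phase \<Rightarrow> real" where
  "ang_mom = (\<lambda>(q, p). \<bar>q$1 * p$2 - q$2 * p$1\<bar>)"


section \<open>Apsidal values and the apsidal angle\<close>

definition f_rad :: "(real \<Rightarrow> real) \<Rightarrow> real \<Rightarrow> real \<Rightarrow> real" where
  "f_rad W E r = 2 * r\<^sup>2 * (E + W r)"

definition has_least :: "real set \<Rightarrow> bool" where
  "has_least A \<longleftrightarrow> (\<exists>r\<in>A. \<forall>s\<in>A. r \<le> s)"

definition first_or_infinity :: "real set \<Rightarrow> ereal" where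
  "first_or_infinity A = (if has_least A then ereal (LEAST r. r \<in> A) else \<infinity>)"

definition first_or_zero :: "real set \<Rightarrow> real" where
  "first_or_zero A = (if has_least A then (LEAST r. r \<in> A) else 0)"

definition P_first :: "(real \<Rightarrow> real) \<Rightarrow> real \<Rightarrow> ereal" where
  "P_first V E = first_or_infinity {r. 0 < r \<and> f_rad V E r = 0}"

text \<open>In the second case \<open>norm q = R\<close> forces \<open>R\<close> to be finite; the momentum is a nonpositive multiple of
  the position (it vanishes if \<open>P = R\<close>).\<close>

definition normalized :: "(real \<Rightarrow> real) \<Rightarrow> ereal \<Rightarrow> real \<Rightarrow> phase \<Rightarrow> bool" where
  "normalized V R E = (\<lambda>(q, p).
     if P_first V E < R
     then ereal (norm q) = P_first V E \<and> p = 0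
     else ereal (norm q) = R \<and> (norm p)\<^sup>2 = 2 * (E + V (norm q)) \<and> (\<exists>c\<ge>0. p = - (c *\<^sub>R q)))"

definition R_plus :: "(real \<Rightarrow> real) \<Rightarrow> real \<Rightarrow> real \<Rightarrow> ereal" where
  "R_plus W E l = first_or_infinity
     {r. 0 < r \<and> f_rad W E r = l\<^sup>2 \<and> deriv (f_rad W E) r < 0}"

definition R_minus :: "(real \<Rightarrow> real) \<Rightarrow> real \<Rightarrow> real \<Rightarrow> real" where
  "R_minus W E l = first_or_zero
     {r. 0 < r \<and> ereal r < R_plus W E l \<and> f_rad W E r = l\<^sup>2 \<and> deriv (f_rad W E) r > 0}"

text \<open>Apsidal angle, inside the ball of radius \<open>R\<close>, of a solution \<open>u\<close> of the system with potential \<open>W\<close>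
  (below, \<open>W = V_reg V \<epsilon>\<close>).\<close>

definition apsidal_angle :: "(real \<Rightarrow> real) \<Rightarrow> ereal \<Rightarrow> (real \<Rightarrow> real^2) \<Rightarrow> real" where
  "apsidal_angle W R u =
     (let E = energy W (initial u); l = ang_mom (initial u)
      in LBINT r = ereal (R_minus W E l) .. min R (R_plus W E l).
           l / (r\<^sup>2 * sqrt (2 * (E + W r) - l\<^sup>2 / r\<^sup>2)))"

text \<open>The filter \<open>(\<epsilon>,\<nu>) \<rightarrow> (0,\<nu>\<^sub>0)\<close> with \<open>\<epsilon> > 0\<close>. Rectilinear motions (\<open>ang_mom \<nu> = 0\<close>) have to be
  excluded: they have no pericentre and sweep no angle before the origin, so that the integral defining
  the apsidal angle is \<open>0\<close> for them, while such \<open>\<nu>\<close> (for instance \<open>\<nu>\<^sub>0\<close> itself) occur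
  arbitrarily close to the limit point.\<close>

definition reg_limit :: "phase \<Rightarrow> (real \<times> phase) filter" where
  "reg_limit \<nu>0 = at (0, \<nu>0) within {(\<epsilon>, \<nu>). \<epsilon> > 0 \<and> ang_mom \<nu> \<noteq> 0}"

end

theory Submission
  imports Defs
begin

text \<open>
  Write \<open>W = V\<^sub>\<epsilon>\<close> and \<open>f(r) = 2r\<^sup>2(E + W(r))\<close>, so that the integrand is \<open>l / (r sqrt (f(r) - l\<^sup>2))\<close>.
  For convex \<open>V\<close>, slow variation (condition (v)) yields \<open>-x V'(x) = o(V(x))\<close> at \<open>0\<close>. Hence on a
  small interval \<open>(0,\<delta>]\<close>, uniformly in \<open>\<epsilon>\<close>, one has \<open>r f'(r) \<ge> a f(r)\<close> with \<open>a < 2\<close> as close to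
  \<open>2\<close> as desired, while \<open>f(r)/r\<^sup>2\<close> decreases. If \<open>r\<^sub>0\<close> is the pericentre, where
  \<open>f(r\<^sub>0) = l\<^sup>2\<close>, then \<open>(r/r\<^sub>0)\<^sup>a \<le> f(r)/l\<^sup>2 \<le> (r/r\<^sub>0)\<^sup>2\<close>, and the integral is squeezed between the
  explicit integrals of \<open>1 / (r sqrt ((r/r\<^sub>0)\<^sup>a - 1))\<close>, whose value over \<open>(r\<^sub>0,\<infinity>)\<close> is \<open>\<pi>/a\<close>.
  On \<open>[\<delta>,\<beta>]\<close> the radicand \<open>2(E + W(r)) - l\<^sup>2/r\<^sup>2\<close> decreases at a uniform linear rate and is nonnegative at
  \<open>\<beta>\<close>, so this part contributes \<open>O(l)\<close>. The ratio condition enters only through \<open>V'(R) < 0\<close>,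
  needed when the apocentre may lie near the boundary of the ball.
\<close>

section \<open>Explicit comparison integrals\<close>

text \<open>Continuity, in the form in which \<open>interval_integral_FTC_nonneg\<close> asks for
  its endpoint limits.\<close>

lemma tendsto_at_ereal:
  fixes A :: "real \<Rightarrow> real"
  assumes "isCont A x"
  shows "((A \<circ> real_of_ereal) \<longlongrightarrow> A x) (at_right (ereal x))"
    and "((A \<circ> real_of_ereal) \<longlongrightarrow> A x) (at_left (ereal x))"
  using assms unfolding ereal_tendsto_simps1 isCont_def
  by (auto intro: filterlim_mono[OF _ order_refl at_le])

text \<open>The substitution \<open>y = sqrt ((r / p) powr a - 1)\<close> turns the integrand into
  \<open>2 / (a * (1 + y^2))\<close>. The kernel is singular at \<open>p\<close>; the nonnegative
  form of the fundamental theorem tolerates this and yields integrability as well.\<close>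

lemma power_kernel_integral:
  fixes a p q :: real
  assumes "0 < a" "0 < p" "p < q"
  defines "D \<equiv> \<lambda>r. 1 / (r * sqrt ((r / p) powr a - 1))"
  shows "set_integrable lborel (einterval p q) D"
    and "(LBINT r=p..q. D r) = 2 / a * arctan (sqrt ((q / p) powr a - 1))"
proof -
  define A where "A = (\<lambda>r. 2 / a * arctan (sqrt ((r / p) powr a - 1)))"
  have gt: "(r / p) powr a > 1" if "p < r" for r
    using that assms by (simp add: gr_one_powr)
  have dA: "(A has_real_derivative D r) (at r)" if "ereal p < ereal r" "ereal r < ereal q" for r
  proof -
    have r: "p < r" "0 < r" using that assms by auto
    define X where "X = (r / p) powr a"
    have X: "X > 1" using gt[OF r(1)] X_def by simp
    have dX: "((\<lambda>r. (r / p) powr a) has_real_derivative (a * X / r)) (at r)"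
      unfolding X_def using r assms by (auto intro!: derivative_eq_intros simp: field_simps powr_diff)
    have dS: "((\<lambda>r. sqrt ((r / p) powr a - 1)) has_real_derivative (inverse (sqrt (X - 1)) / 2 * (a * X / r))) (at r)"
      by (rule DERIV_chain2[OF DERIV_real_sqrt DERIV_diff[OF dX DERIV_const, THEN DERIV_cong], folded X_def])
         (use X in auto)
    have "(A has_real_derivative 2 / a * (inverse (1 + (sqrt (X - 1))\<^sup>2) * (inverse (sqrt (X - 1)) / 2 * (a * X / r)))) (at r)"
      unfolding A_def
      by (rule DERIV_cmult, rule DERIV_chain2[OF DERIV_arctan dS, folded X_def])
    moreover have "2 / a * (inverse (1 + (sqrt (X - 1))\<^sup>2) * (inverse (sqrt (X - 1)) / 2 * (a * X / r))) = D r"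
    proof -
      have "1 + (sqrt (X - 1))\<^sup>2 = X" "sqrt (X - 1) > 0" using X by auto
      thus ?thesis using X r assms(1) by (simp add: D_def flip: X_def) (simp add: field_simps)
    qed
    ultimately show ?thesis by simp
  qed
  have cD: "isCont D r" if "ereal p < ereal r" "ereal r < ereal q" for r
    using that assms gt[of r] unfolding D_def by (intro continuous_intros) auto
  have nn: "AE r in lborel. ereal p < ereal r \<longrightarrow> ereal r < ereal q \<longrightarrow> 0 \<le> D r"
    using gt assms by (intro AE_I2) (auto simp: D_def less_imp_le)
  have cA: "isCont A r" if "p \<le> r" for r
    using that assms unfolding A_def by (intro continuous_intros) auto
  have lt: "ereal p < ereal q" using assms by simp
  note * = interval_integral_FTC_nonneg[OF lt dA cD nn
    tendsto_at_ereal(1)[OF cA[OF order_refl]]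
    tendsto_at_ereal(2)[OF cA[OF less_imp_le[OF assms(3)]]]]
  show "set_integrable lborel (einterval p q) D" by (rule *(1))
  show "(LBINT r=p..q. D r) = 2 / a * arctan (sqrt ((q / p) powr a - 1))"
    using *(2) assms by (simp add: A_def)
qed

text \<open>Majorant for the outer part of the orbit: the radicand may vanish at the upper end
  point, but it stays above a linear function that vanishes there.\<close>

lemma inverse_sqrt_integral:
  fixes K p q :: real
  assumes "0 \<le> K" "p < q"
  shows "set_integrable lborel (einterval p q) (\<lambda>r. K / sqrt (q - r))"
    and "(LBINT r=p..q. K / sqrt (q - r)) = 2 * K * sqrt (q - p)"
proof -
  define A where "A = (\<lambda>r. - 2 * K * sqrt (q - r))"
  have dA: "(A has_real_derivative K / sqrt (q - r)) (at r)" if "ereal p < ereal r" "ereal r < ereal q" for r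
    using that unfolding A_def by (auto intro!: derivative_eq_intros simp: field_simps)
  have cD: "isCont (\<lambda>r. K / sqrt (q - r)) r" if "ereal p < ereal r" "ereal r < ereal q" for r
    using that by (intro continuous_intros) auto
  have nn: "AE r in lborel. ereal p < ereal r \<longrightarrow> ereal r < ereal q \<longrightarrow> 0 \<le> K / sqrt (q - r)"
    using assms by (intro AE_I2) auto
  have cA: "isCont A r" for r
    unfolding A_def by (intro continuous_intros)
  have lt: "ereal p < ereal q" using assms by simp
  note * = interval_integral_FTC_nonneg[OF lt dA cD nn
    tendsto_at_ereal(1)[OF cA] tendsto_at_ereal(2)[OF cA]]
  show "set_integrable lborel (einterval p q) (\<lambda>r. K / sqrt (q - r))" by (rule *(1))
  show "(LBINT r=p..q. K / sqrt (q - r)) = 2 * K * sqrt (q - p)"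
    using *(2) assms by (simp add: A_def)
qed

text \<open>\<open>G\<close> inherits integrability from the majorant \<open>D1 + D2\<close>. The
  minorant is compared on \<open>(p, m)\<close> only, since \<open>0 \<le> G\<close> disposes of the
  rest. The two majorants serve the singularities at the two end points.\<close>

lemma interval_integral_sandwich:
  fixes G D0 D1 D2 :: "real \<Rightarrow> real" and p m q :: real
  assumes "p < m" "m \<le> q"
    and cont: "continuous_on {p<..<q} G"
    and nonneg: "\<And>r. p < r \<Longrightarrow> r < q \<Longrightarrow> 0 \<le> G r"
    and lower: "\<And>r. p < r \<Longrightarrow> r < m \<Longrightarrow> D0 r \<le> G r"
    and upper: "\<And>r. p < r \<Longrightarrow> r < q \<Longrightarrow> G r \<le> D1 r + D2 r"
    and D0: "set_integrable lborel (einterval p m) D0"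
    and D1: "set_integrable lborel (einterval p q) D1"
    and D2: "set_integrable lborel (einterval p q) D2"
  shows "(LBINT r=p..m. D0 r) \<le> (LBINT r=p..q. G r)"
    and "(LBINT r=p..q. G r) \<le> (LBINT r=p..q. D1 r) + (LBINT r=p..q. D2 r)"
proof -
  have e: "einterval (ereal x) (ereal y) = {x<..<y}" for x y
    by (auto simp: einterval_def)
  have meas: "set_borel_measurable lborel {p<..<q} G"
    using borel_measurable_continuous_on_indicator[OF _ cont]
    unfolding set_borel_measurable_def by simp
  have D12: "set_integrable lborel {p<..<q} (\<lambda>r. D1 r + D2 r)"
    using set_integral_add(1)[OF D1 D2] e by simp
  have G: "set_integrable lborel {p<..<q} G"
    by (rule set_integrable_bound[OF D12 meas]) (use nonneg upper in \<open>force intro!: AE_I2\<close>)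
  have "(LBINT r:{p<..<m}. D0 r) \<le> (LBINT r:{p<..<q}. G r)"
    unfolding set_lebesgue_integral_def
    by (rule integral_mono) (use D0 G e nonneg lower assms(1,2) in \<open>auto simp: set_integrable_def indicator_def\<close>)
  thus "(LBINT r=p..m. D0 r) \<le> (LBINT r=p..q. G r)"
    using assms by (simp add: interval_lebesgue_integral_def e)
  have "(LBINT r:{p<..<q}. G r) \<le> (LBINT r:{p<..<q}. D1 r + D2 r)"
    by (rule set_integral_mono[OF G D12]) (use upper in auto)
  also have "\<dots> = (LBINT r:{p<..<q}. D1 r) + (LBINT r:{p<..<q}. D2 r)"
    using set_integral_add(2)[OF D1 D2] e by simp
  finally show "(LBINT r=p..q. G r) \<le> (LBINT r=p..q. D1 r) + (LBINT r=p..q. D2 r)"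
    using assms by (simp add: interval_lebesgue_integral_def e)
qed

section \<open>Bounds for the apsidal integral at fixed parameters\<close>

text \<open>A Gronwall argument in the variable \<open>ln x\<close>: the differential inequality
  makes \<open>f x * x powr (-a)\<close> nondecreasing.\<close>

lemma power_growth:
  fixes f f' :: "real \<Rightarrow> real"
  assumes "0 < p" "p \<le> r"
    and "\<And>x. p \<le> x \<Longrightarrow> x \<le> r \<Longrightarrow> (f has_real_derivative f' x) (at x)"
    and "\<And>x. p \<le> x \<Longrightarrow> x \<le> r \<Longrightarrow> a * f x \<le> x * f' x"
  shows "f p * (r / p) powr a \<le> f r"
proof -
  have "f p * p powr (-a) \<le> f r * r powr (-a)"
  proof (rule DERIV_nonneg_imp_nondecreasing[OF assms(2)])
    fix x assume x: "p \<le> x" "x \<le> r"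
    hence x0: "x > 0" using assms by simp
    have "((\<lambda>x. f x * x powr (-a)) has_real_derivative (f' x * x powr (-a) + (-a * x powr (-a - 1)) * f x)) (at x)"
      by (rule DERIV_mult'[OF assms(3)[OF x] has_real_derivative_powr[OF x0], THEN DERIV_cong]) simp
    moreover have "f' x * x powr (-a) + (-a * x powr (-a - 1)) * f x = x powr (-a-1) * (x * f' x - a * f x)"
      using x0 by (simp add: powr_diff field_simps)
    ultimately show "\<exists>y. ((\<lambda>x. f x * x powr (-a)) has_real_derivative y) (at x) \<and> 0 \<le> y"
      using assms(4)[OF x] by (metis diff_ge_0_iff_ge mult_nonneg_nonneg powr_ge_zero)
  qed
  thus ?thesis using assms(1,2) by (simp add: powr_minus powr_divide field_simps)
qed

text \<open>The angle as a function of energy and angular momentum, so that it can be estimated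
  without a trajectory.\<close>

definition apsidal_integral :: "(real \<Rightarrow> real) \<Rightarrow> ereal \<Rightarrow> real \<Rightarrow> real \<Rightarrow> real" where
  "apsidal_integral W R e l = (LBINT r = ereal (R_minus W e l) .. min R (R_plus W e l).
     l / (r\<^sup>2 * sqrt (2 * (e + W r) - l\<^sup>2 / r\<^sup>2)))"

text \<open>The second alternative of \<open>at_b\<close> is the case of an orbit leaving the ball of radius \<open>R\<close>.\<close>

lemma apsidal_integral_bounds:
  fixes W W' :: "real \<Rightarrow> real" and a c l e \<delta> b :: real and R :: ereal
  assumes W': "\<And>r. 0 < r \<Longrightarrow> (W has_real_derivative W' r) (at r)"
    and cont: "continuous_on {0..} W"
    and pos: "0 < a" "0 < l" "0 < c" "0 < \<delta>" "\<delta> < b" "ereal \<delta> < R"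
    and inner: "\<And>r. 0 < r \<Longrightarrow> r \<le> \<delta> \<Longrightarrow> 0 < e + W r"
      "\<And>r. 0 < r \<Longrightarrow> r \<le> \<delta> \<Longrightarrow> - (2 - a) * (e + W r) \<le> r * W' r"
    and decr: "\<And>r. 0 < r \<Longrightarrow> r \<le> b \<Longrightarrow> W' r \<le> 0"
    and outer: "\<And>r. \<delta> \<le> r \<Longrightarrow> r \<le> b \<Longrightarrow> 2 * W' r + 2 * l\<^sup>2 / r ^ 3 \<le> - c"
    and at_\<delta>: "0 < 2 * (e + W \<delta>) - l\<^sup>2 / \<delta>\<^sup>2"
    and at_b: "2 * (e + W b) - l\<^sup>2 / b\<^sup>2 < 0 \<or> R = ereal b \<and> 0 < 2 * (e + W b) - l\<^sup>2 / b\<^sup>2"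
  shows "arctan (sqrt (2 * \<delta>\<^sup>2 * (e + W \<delta>) / l\<^sup>2 - 1)) \<le> apsidal_integral W R e l"
    and "apsidal_integral W R e l \<le> pi / a + 2 * (l / (\<delta>\<^sup>2 * sqrt c)) * sqrt b"
proof -
  define f where "f = f_rad W e"
  define f' where "f' = (\<lambda>r. 4 * r * (e + W r) + 2 * r\<^sup>2 * W' r)"
  define \<Phi> where "\<Phi> = (\<lambda>r. 2 * (e + W r) - l\<^sup>2 / r\<^sup>2)"
  define G where "G = (\<lambda>r. l / (r\<^sup>2 * sqrt (\<Phi> r)))"
  have f_eq: "f r = 2 * r\<^sup>2 * (e + W r)" for r
    by (simp add: f_def f_rad_def)
  have f\<Phi>: "f r = r\<^sup>2 * \<Phi> r + l\<^sup>2" if "r > 0" for r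
    using that by (simp add: f_eq \<Phi>_def field_simps)
  have df: "(f has_real_derivative f' r) (at r)" if "r > 0" for r
    unfolding f_eq f'_def using W'[OF that]
    by (auto intro!: derivative_eq_intros simp: algebra_simps power2_eq_square)
  have deriv_f: "deriv f r = f' r" if "r > 0" for r
    using DERIV_imp_deriv[OF df[OF that]] .
  have d\<Phi>: "(\<Phi> has_real_derivative 2 * W' r + 2 * l\<^sup>2 / r ^ 3) (at r)" if "r > 0" for r
    unfolding \<Phi>_def using W'[OF that] that
    by (auto intro!: derivative_eq_intros simp: field_simps power2_eq_square power3_eq_cube)
  \<comment> \<open>Here \<open>r * f' r = 2 * f r + 2 * r ^ 3 * W' r\<close>, and the second
    assumption \<open>inner\<close>, multiplied by \<open>2 * r\<^sup>2\<close>, bounds the last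
    term below by \<open>- (2 - a) * f r\<close>.\<close>
  have grow: "a * f r \<le> r * f' r" if "0 < r" "r \<le> \<delta>" for r
  proof -
    have "2 * r\<^sup>2 * (- (2 - a) * (e + W r)) \<le> 2 * r\<^sup>2 * (r * W' r)"
      using inner(2)[OF that] by (intro mult_left_mono) auto
    thus ?thesis by (simp add: f_eq f'_def algebra_simps power2_eq_square)
  qed
  have f_pos: "0 < f r" if "0 < r" "r \<le> \<delta>" for r
    using inner(1)[OF that] that by (simp add: f_eq)
  have f'_pos: "0 < f' r" if "0 < r" "r \<le> \<delta>" for r
  proof -
    have "0 < a * f r" using f_pos[OF that] pos by simp
    hence "0 < r * f' r" using grow[OF that] by linarith
    thus ?thesis using that by (simp add: zero_less_mult_iff)
  qed
  have f_strict: "f x < f y" if "0 < x" "x < y" "y \<le> \<delta>" for x y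
    by (rule DERIV_pos_imp_increasing[OF that(2)]) (use df f'_pos that in force)
  have \<Phi>_drop: "c * (y - x) \<le> \<Phi> x - \<Phi> y" if "\<delta> \<le> x" "x \<le> y" "y \<le> b" for x y
  proof -
    have "\<Phi> y + c * y \<le> \<Phi> x + c * x"
    proof (rule DERIV_nonpos_imp_nonincreasing[OF that(2)])
      fix r assume r: "x \<le> r" "r \<le> y"
      have "((\<lambda>r. \<Phi> r + c * r) has_real_derivative (2 * W' r + 2 * l\<^sup>2 / r ^ 3 + c)) (at r)"
        by (rule DERIV_cong[OF DERIV_add[OF d\<Phi> DERIV_cmult[OF DERIV_ident]]]) (use r that pos in auto)
      thus "\<exists>z. ((\<lambda>r. \<Phi> r + c * r) has_real_derivative z) (at r) \<and> z \<le> 0"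
        using outer[of r] r that by force
    qed
    thus ?thesis by (simp add: algebra_simps)
  qed

  \<comment> \<open>Existence of the pericentre:
    \<open>f 0 = 0 < l\<^sup>2 \<le> f \<delta>\<close>. Continuity of \<open>W\<close> up to
    \<open>0\<close>, which a regularized potential has, makes the intermediate value theorem
    applicable.\<close>
  have "\<exists>r0\<ge>0. r0 \<le> \<delta> \<and> f r0 = l\<^sup>2"
  proof (rule IVT')
    have "0 < \<delta>\<^sup>2 * \<Phi> \<delta>" using at_\<delta> pos by (auto simp: \<Phi>_def)
    thus "l\<^sup>2 \<le> f \<delta>" using f\<Phi>[of \<delta>] pos by simp
    show "continuous_on {0..\<delta>} f"
      unfolding f_eq by (intro continuous_intros continuous_on_subset[OF cont]) auto
  qed (use pos in \<open>auto simp: f_eq\<close>)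
  then obtain r0 where r0: "r0 \<ge> 0" "r0 \<le> \<delta>" "f r0 = l\<^sup>2" by blast
  have r0_pos: "r0 > 0"
    using r0 pos by (cases "r0 = 0") (auto simp: f_eq)
  have r0_lt: "r0 < \<delta>"
    using r0 at_\<delta> f\<Phi>[of \<delta>] pos by (cases "r0 = \<delta>") (auto simp: \<Phi>_def)

  define Ap where "Ap = {r. 0 < r \<and> f r = l\<^sup>2 \<and> deriv f r < 0}"
  have Ap_gt: "\<delta> < r" "\<Phi> r = 0" if "r \<in> Ap" for r
    using that f'_pos[of r] deriv_f[of r] f\<Phi>[of r] by (force simp: Ap_def)+
  have Rp: "R_plus W e l = (if has_least Ap then ereal (LEAST r. r \<in> Ap) else \<infinity>)"
    by (simp add: R_plus_def first_or_infinity_def Ap_def f_def)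
  \<comment> \<open>The upper limit \<open>\<beta>\<close> of the integral is finite, and the
    radicand is nonnegative there, whether the orbit turns back or leaves the ball first.\<close>
  have "\<exists>\<beta>. min R (R_plus W e l) = ereal \<beta> \<and> \<delta> < \<beta> \<and> \<beta> \<le> b \<and> 0 \<le> \<Phi> \<beta> \<and> ereal \<delta> < R_plus W e l"
    using at_b
  proof
    assume b: "2 * (e + W b) - l\<^sup>2 / b\<^sup>2 < 0"
    have "\<exists>r\<ge>\<delta>. r \<le> b \<and> \<Phi> r = 0"
    proof (rule IVT2')
      have "isCont \<Phi> x" if "x \<in> {\<delta>..b}" for x
        using that pos by (intro DERIV_isCont[OF d\<Phi>]) auto
      thus "continuous_on {\<delta>..b} \<Phi>" by (simp add: continuous_at_imp_continuous_on)
    qed (use b at_\<delta> pos in \<open>auto simp: \<Phi>_def\<close>)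
    then obtain rp where rp: "\<delta> \<le> rp" "rp \<le> b" "\<Phi> rp = 0" by blast
    have rp\<delta>: "\<delta> < rp" using rp at_\<delta> by (cases "rp = \<delta>") (auto simp: \<Phi>_def)
    have rp0: "rp > 0" using rp\<delta> pos by simp
    \<comment> \<open>Since \<open>f r = r\<^sup>2 * \<Phi> r + l\<^sup>2\<close>, the derivatives
      of \<open>f\<close> and of \<open>\<Phi>\<close> have the same sign at a zero of
      \<open>\<Phi>\<close>. So this zero is an apocentre.\<close>
    have "f' rp = rp\<^sup>2 * (2 * W' rp + 2 * l\<^sup>2 / rp ^ 3)"
    proof -
      have "l\<^sup>2 = 2 * (e + W rp) * rp\<^sup>2" using rp(3) rp0 by (simp add: \<Phi>_def field_simps)
      thus ?thesis using rp0 by (simp add: f'_def field_simps power2_eq_square power3_eq_cube)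
    qed
    moreover have "2 * W' rp + 2 * l\<^sup>2 / rp ^ 3 < 0" using outer[OF rp(1,2)] pos by linarith
    ultimately have "f' rp < 0" using rp0 by (simp add: mult_pos_neg)
    hence rp_in: "rp \<in> Ap" using rp0 rp(3) f\<Phi>[of rp] deriv_f by (simp add: Ap_def)
    have least: "rp \<le> r" if "r \<in> Ap" for r
    proof (rule ccontr)
      assume "\<not> rp \<le> r"
      hence "0 < c * (rp - r)" using pos by simp
      thus False using \<Phi>_drop[of r rp] Ap_gt[OF that] rp \<open>\<not> rp \<le> r\<close> by simp
    qed
    have "(LEAST r. r \<in> Ap) = rp" using rp_in least by (rule Least_equality)
    moreover have "has_least Ap" using rp_in least by (auto simp: has_least_def)
    ultimately have Rp_eq: "R_plus W e l = ereal rp" using Rp by simp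
    show ?thesis
    proof (cases "R \<le> ereal rp")
      case True
      then obtain \<beta> where \<beta>: "R = ereal \<beta>" using pos(6) by (cases R) auto
      hence \<beta>': "\<delta> < \<beta>" "\<beta> \<le> rp" using True pos(6) by auto
      have "0 \<le> c * (rp - \<beta>)" using \<beta>' pos by simp
      hence "0 \<le> \<Phi> \<beta>" using \<Phi>_drop[of \<beta> rp] \<beta>' rp by simp
      thus ?thesis using \<beta> \<beta>' rp rp\<delta> by (intro exI[of _ \<beta>]) (auto simp: Rp_eq min_def)
    next
      case False
      thus ?thesis using rp rp\<delta> by (intro exI[of _ rp]) (auto simp: Rp_eq min_def)
    qed
  next
    assume b: "R = ereal b \<and> 0 < 2 * (e + W b) - l\<^sup>2 / b\<^sup>2"
    hence b\<Phi>: "0 < \<Phi> b" by (simp add: \<Phi>_def)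
    \<comment> \<open>\<open>\<Phi>\<close> decreases on \<open>[\<delta>, b]\<close> and is still
      positive at \<open>b\<close>, so any apocentre lies beyond \<open>b\<close> and the integral
      is cut off at \<open>R\<close>.\<close>
    have gt: "b < r" if "r \<in> Ap" for r
    proof (rule ccontr)
      assume "\<not> b < r"
      moreover have "0 \<le> c * (b - r)" using calculation pos by simp
      ultimately show False using \<Phi>_drop[of r b] Ap_gt[OF that] b\<Phi> by simp
    qed
    have "ereal b < R_plus W e l"
    proof (cases "has_least Ap")
      case True
      then obtain r where "r \<in> Ap" "\<forall>s\<in>Ap. r \<le> s" by (auto simp: has_least_def)
      hence "(LEAST r. r \<in> Ap) = r" by (intro Least_equality) auto
      thus ?thesis using Rp True gt[OF \<open>r \<in> Ap\<close>] by simp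
    qed (simp add: Rp)
    moreover have "ereal \<delta> < ereal b" using pos by simp
    ultimately show ?thesis using b b\<Phi> pos
      by (intro exI[of _ b]) (auto simp: min_def simp del: less_ereal.simps intro: less_trans)
  qed
  then obtain \<beta> where \<beta>: "min R (R_plus W e l) = ereal \<beta>" "\<delta> < \<beta>" "\<beta> \<le> b" "0 \<le> \<Phi> \<beta>"
    and Rp_gt: "ereal \<delta> < R_plus W e l" by blast

  define Am where "Am = {r. 0 < r \<and> ereal r < R_plus W e l \<and> f r = l\<^sup>2 \<and> deriv f r > 0}"
  have "ereal r0 < R_plus W e l" using r0_lt Rp_gt by (metis ereal_less_eq(3) less_imp_le order_le_less_trans)
  hence r0_in: "r0 \<in> Am" using r0 r0_pos f'_pos deriv_f by (simp add: Am_def)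
  have Am_least: "r0 \<le> r" if "r \<in> Am" for r
    using that f_strict[of r r0] r0 by (force simp: Am_def)
  have "(LEAST r. r \<in> Am) = r0" using r0_in Am_least by (rule Least_equality)
  moreover have "has_least Am" using r0_in Am_least by (auto simp: has_least_def)
  ultimately have Rm: "R_minus W e l = r0"
    by (simp add: R_minus_def first_or_zero_def Am_def f_def)

  have I: "apsidal_integral W R e l = (LBINT r=r0..\<beta>. G r)"
    unfolding apsidal_integral_def Rm \<beta>(1) G_def \<Phi>_def ..
  have \<Phi>_lower: "c * (\<beta> - r) \<le> \<Phi> r" if "\<delta> \<le> r" "r \<le> \<beta>" for r
    using \<Phi>_drop[OF that \<beta>(3)] \<beta>(4) by simp
  have \<Phi>_pos: "0 < \<Phi> r" if "r0 < r" "r < \<beta>" for r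
  proof (cases "r \<le> \<delta>")
    case True
    have "0 < r\<^sup>2 * \<Phi> r" using f_strict[OF r0_pos that(1) True] f\<Phi>[of r] that r0_pos r0 by simp
    thus ?thesis by (simp add: zero_less_mult_iff)
  next
    case False
    have "0 < c * (\<beta> - r)" using pos that by simp
    thus ?thesis using \<Phi>_lower[of r] False that by simp
  qed
  have sq: "r * sqrt (\<Phi> r) = sqrt (r\<^sup>2 * \<Phi> r)" "l * sqrt x = sqrt (l\<^sup>2 * x)" if "0 < r" for r x
    using that pos by (auto simp: real_sqrt_mult)
  define D where "D = (\<lambda>a r. 1 / (r * sqrt ((r / r0) powr a - 1)))"
  \<comment> \<open>For \<open>\<delta> \<le> r\<close> one has
    \<open>\<delta>\<^sup>2 \<le> r\<^sup>2\<close> and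
    \<open>c * (\<beta> - r) \<le> \<Phi> r\<close>, so that \<open>K / sqrt (\<beta> - r)\<close>
    bounds \<open>G r\<close>.\<close>
  define K where "K = l / (\<delta>\<^sup>2 * sqrt c)"
  have K: "K \<ge> 0" using pos by (simp add: K_def)
  have gt1: "(r / r0) powr a > 1" if "r0 < r" "a > 0" for r a
    using that r0_pos by (simp add: gr_one_powr)
  have F_le: "e + W r \<le> e + W r0" if "r0 \<le> r" "r \<le> b" for r
  proof -
    have "W r \<le> W r0"
      by (rule DERIV_nonpos_imp_nonincreasing[OF that(1)]) (use W' decr that r0_pos in force)
    thus ?thesis by simp
  qed
  have l_sq: "l\<^sup>2 = 2 * r0\<^sup>2 * (e + W r0)" using r0(3) f_eq by simp
  have frac1: "1 / (r * y) \<le> l / (r\<^sup>2 * x)" if "0 < r" "0 < x" "0 < y" "r * x \<le> l * y" for r x y :: real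
  proof -
    have "1 / (r * y) = (r * x) / (r\<^sup>2 * x * y)" using that by (simp add: power2_eq_square)
    also have "\<dots> \<le> (l * y) / (r\<^sup>2 * x * y)" using that by (intro divide_right_mono) auto
    also have "\<dots> = l / (r\<^sup>2 * x)" using that by simp
    finally show ?thesis .
  qed
  have frac2: "l / (r\<^sup>2 * x) \<le> 1 / (r * y)" if "0 < r" "0 < x" "0 < y" "l * y \<le> r * x" for r x y :: real
  proof -
    have "l / (r\<^sup>2 * x) = (l * y) / (r\<^sup>2 * x * y)" using that by simp
    also have "\<dots> \<le> (r * x) / (r\<^sup>2 * x * y)" using that by (intro divide_right_mono) auto
    also have "\<dots> = 1 / (r * y)" using that by (simp add: power2_eq_square)
    finally show ?thesis .
  qed
  \<comment> \<open>\<open>W\<close> is nonincreasing, hence \<open>f r / r\<^sup>2\<close> is at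
    most its value at \<open>r0\<close>. Exponent \<open>2\<close> is the kernel of free motion
    along a straight line.\<close>
  have lower: "D 2 r \<le> G r" if "r0 < r" "r < \<delta>" for r
  proof -
    have r: "r > 0" using that r0_pos by simp
    have "f r \<le> l\<^sup>2 * (r / r0)\<^sup>2"
    proof -
      have "f r \<le> 2 * r\<^sup>2 * (e + W r0)"
        unfolding f_eq using F_le[of r] that pos by (intro mult_left_mono) auto
      also have "\<dots> = l\<^sup>2 * (r / r0)\<^sup>2" using r0_pos by (simp add: l_sq field_simps)
      finally show ?thesis .
    qed
    hence "r * sqrt (\<Phi> r) \<le> l * sqrt ((r / r0) powr 2 - 1)"
      unfolding sq[OF r] using f\<Phi>[OF r] r r0_pos by (simp add: algebra_simps)
    thus ?thesis
      unfolding D_def G_def using r \<Phi>_pos[of r] gt1[of r 2] that \<beta> by (intro frac1) auto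
  qed
  have nonneg: "0 \<le> G r" if "r0 < r" "r < \<beta>" for r
    using \<Phi>_pos[OF that] pos by (simp add: G_def)
  \<comment> \<open>Both majorants are nonnegative, so it suffices that the first bounds
    \<open>G\<close> up to \<open>\<delta>\<close> and the second beyond it.\<close>
  have upper: "G r \<le> D a r + K / sqrt (\<beta> - r)" if "r0 < r" "r < \<beta>" for r
  proof (cases "r \<le> \<delta>")
    case True
    have r: "r > 0" using that r0_pos by simp
    have "l\<^sup>2 * (r / r0) powr a \<le> f r"
      using power_growth[OF r0_pos, of r f f' a] df grow that True r0_pos r0 by auto
    hence "l * sqrt ((r / r0) powr a - 1) \<le> r * sqrt (\<Phi> r)"
      unfolding sq[OF r] using f\<Phi>[OF r] by (simp add: algebra_simps)
    hence "G r \<le> D a r"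
      unfolding D_def G_def using r \<Phi>_pos[OF that] gt1[of r a] that pos by (intro frac2) auto
    moreover have "0 \<le> K / sqrt (\<beta> - r)" using K that by simp
    ultimately show ?thesis by linarith
  next
    case False
    have "\<delta>\<^sup>2 * sqrt c * sqrt (\<beta> - r) \<le> r\<^sup>2 * sqrt (\<Phi> r)"
      unfolding mult.assoc real_sqrt_mult[symmetric]
      using False pos \<Phi>_lower[of r] that by (intro mult_mono power_mono) auto
    moreover have "0 < \<delta>\<^sup>2 * sqrt c * sqrt (\<beta> - r)" using pos that by simp
    ultimately have "G r \<le> K / sqrt (\<beta> - r)"
      using pos by (simp add: G_def K_def divide_left_mono)
    moreover have "0 \<le> D a r" using gt1[OF that(1) pos(1)] that r0_pos by (simp add: D_def)
    ultimately show ?thesis by linarith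
  qed
  have G_cont: "continuous_on {r0<..<\<beta>} G"
  proof -
    have "isCont \<Phi> r" if "r0 < r" for r
      using that r0_pos by (intro DERIV_isCont[OF d\<Phi>]) auto
    hence "isCont G r" if "r0 < r" "r < \<beta>" for r
      unfolding G_def using that \<Phi>_pos[OF that] r0_pos by (intro continuous_intros) auto
    thus ?thesis by (auto intro!: continuous_at_imp_continuous_on)
  qed
  have r0\<beta>: "r0 < \<beta>" using r0_lt \<beta> by simp
  note sandwich = interval_integral_sandwich[OF r0_lt less_imp_le[OF \<beta>(2)] G_cont nonneg lower upper]
  have D0_int: "set_integrable lborel (einterval r0 \<delta>) (D 2)"
    "(LBINT r=r0..\<delta>. D 2 r) = arctan (sqrt ((\<delta> / r0) powr 2 - 1))"
    using power_kernel_integral[of 2, OF _ r0_pos r0_lt] by (simp_all add: D_def)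
  have D1_int: "set_integrable lborel (einterval r0 \<beta>) (D a)"
    "(LBINT r=r0..\<beta>. D a r) = 2 / a * arctan (sqrt ((\<beta> / r0) powr a - 1))"
    using power_kernel_integral[OF pos(1) r0_pos r0\<beta>] by (simp_all add: D_def)
  note D2_int = inverse_sqrt_integral[OF K r0\<beta>]
  note sandwich = sandwich[OF _ _ _ _ _ _ D0_int(1) D1_int(1) D2_int(1)]
  \<comment> \<open>The unknown pericentre is eliminated: monotonicity of \<open>W\<close> bounds
    \<open>(\<delta> / r0)\<^sup>2\<close> below by a quantity in \<open>\<delta>\<close>,
    \<open>e\<close> and \<open>l\<close> that can be followed to the limit.\<close>
  have "2 * \<delta>\<^sup>2 * (e + W \<delta>) \<le> 2 * \<delta>\<^sup>2 * (e + W r0)"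
    using F_le[of \<delta>] r0_lt pos by (intro mult_left_mono) auto
  also have "\<dots> = (\<delta> / r0) powr 2 * l\<^sup>2" using r0_pos pos by (simp add: l_sq power_divide)
  finally have "2 * \<delta>\<^sup>2 * (e + W \<delta>) / l\<^sup>2 \<le> (\<delta> / r0) powr 2"
    using pos by (simp add: field_simps)
  hence "arctan (sqrt (2 * \<delta>\<^sup>2 * (e + W \<delta>) / l\<^sup>2 - 1)) \<le> arctan (sqrt ((\<delta> / r0) powr 2 - 1))"
    by (simp add: arctan_le_iff)
  thus "arctan (sqrt (2 * \<delta>\<^sup>2 * (e + W \<delta>) / l\<^sup>2 - 1)) \<le> apsidal_integral W R e l"
    unfolding I using sandwich(1) D0_int(2) by simp
  have "2 / a * arctan (sqrt ((\<beta> / r0) powr a - 1)) \<le> 2 / a * (pi / 2)"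
    using pos arctan_ubound by (intro mult_left_mono) (auto intro: less_imp_le)
  moreover have "2 * K * sqrt (\<beta> - r0) \<le> 2 * K * sqrt b"
    using K \<beta> r0_pos by (intro mult_left_mono) auto
  ultimately show "apsidal_integral W R e l \<le> pi / a + 2 * (l / (\<delta>\<^sup>2 * sqrt c)) * sqrt b"
    unfolding I using sandwich(2) D1_int(2) D2_int(2) by (simp add: K_def)
qed

section \<open>The potential near the origin and near the boundary of the ball\<close>

lemma smooth_pos_derivs:
  assumes "smooth_pos V" "0 < x"
  shows "(V has_real_derivative deriv V x) (at x)"
    and "(deriv V has_real_derivative deriv (deriv V) x) (at x)"
proof -
  have "((deriv ^^ 0) V) differentiable (at x)" "((deriv ^^ 1) V) differentiable (at x)"
    using assms unfolding smooth_pos_def by blast+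
  thus "(V has_real_derivative deriv V x) (at x)"
    "(deriv V has_real_derivative deriv (deriv V) x) (at x)"
    by (auto simp: DERIV_deriv_iff_real_differentiable)
qed

text \<open>By convexity the slope at \<open>x\<close> is at least the mean slope over
  \<open>[x/2, x]\<close>, so \<open>- x * deriv V x \<le> 2 * (V (x/2) - V x)\<close>. Slow
  variation with ratio \<open>2\<close> makes this difference small compared with
  \<open>V x\<close>.\<close>

lemma class_V_star_log_derivative:
  assumes V: "V \<in> class_V_star" and S: "convexity_radius V S" and "0 < \<eta>"
  shows "\<exists>d>0. \<forall>x. 0 < x \<longrightarrow> x < d \<longrightarrow> - x * deriv V x \<le> \<eta> * V x"
proof -
  \<comment> \<open>The bound \<open>1/4\<close> gives \<open>V (x/2) \<le> 2 * V x\<close>; the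
    bound \<open>\<eta> / 4\<close> absorbs the factor \<open>4\<close> in the final
    estimate.\<close>
  define \<kappa> where "\<kappa> = min (1/4) (\<eta> / 4)"
  have \<kappa>: "0 < \<kappa>" "\<kappa> \<le> 1/4" "4 * \<kappa> \<le> \<eta>" using assms by (auto simp: \<kappa>_def)
  have smooth: "smooth_pos V" and top: "filterlim V at_top (at_right 0)"
    and lim: "uniform_limit {1..2} (\<lambda>s x. V (s * x) / V s) (\<lambda>_. 1) (at_right 0)"
    using V by (auto simp: class_V_star_def class_V_def)
  have "\<forall>\<^sub>F s in at_right 0. \<forall>x\<in>{1..2}. dist (V (s * x) / V s) 1 < \<kappa>"
    using uniform_limitD[OF lim \<kappa>(1)] .
  hence "\<forall>\<^sub>F s in at_right 0. dist (V (s * 2) / V s) 1 < \<kappa>"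
    by eventually_elim auto
  moreover have "\<forall>\<^sub>F s in at_right 0. 0 < V s"
    using top by (simp add: filterlim_at_top_dense)
  ultimately have "\<forall>\<^sub>F s in at_right 0. dist (V (s * 2) / V s) 1 < \<kappa> \<and> 0 < V s"
    by (rule eventually_conj)
  then obtain d1 where d1: "d1 > 0" "\<And>s. 0 < s \<Longrightarrow> s < d1 \<Longrightarrow> dist (V (s * 2) / V s) 1 < \<kappa> \<and> 0 < V s"
    unfolding eventually_at_right_field by auto
  obtain d2 where d2: "0 < ereal d2" "ereal d2 < S"
    using S ereal_dense2[of 0 S] by (auto simp: convexity_radius_def)
  have conv: "0 < deriv (deriv V) x" if "0 < x" "x \<le> d2" for x
    using S d2 that order_le_less_trans[of "ereal x" "ereal d2" S] by (auto simp: convexity_radius_def)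
  have "- x * deriv V x \<le> \<eta> * V x" if x: "0 < x" "x < min d1 d2" for x
  proof -
    have "\<exists>z>x/2. z < x \<and> V x - V (x/2) = (x - x/2) * deriv V z"
      using x by (intro MVT2 smooth_pos_derivs(1)[OF smooth]) auto
    then obtain z where z: "x/2 < z" "z < x" "V x - V (x/2) = (x/2) * deriv V z"
      by (auto simp: field_simps)
    have "deriv V z \<le> deriv V x"
    proof (rule DERIV_nonneg_imp_nondecreasing[OF less_imp_le[OF z(2)]])
      fix y assume "z \<le> y" "y \<le> x"
      thus "\<exists>d. (deriv V has_real_derivative d) (at y) \<and> 0 \<le> d"
        using x z conv[of y] by (intro exI[of _ "deriv (deriv V) y"] conjI smooth_pos_derivs(2)[OF smooth]) auto
    qed
    hence "x * deriv V z \<le> x * deriv V x" using x by (intro mult_left_mono) auto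
    moreover have "x * deriv V z = 2 * (V x - V (x/2))" using z(3) by simp
    ultimately have "2 * (V x - V (x/2)) \<le> x * deriv V x" by metis
    hence 1: "- x * deriv V x \<le> 2 * (V (x/2) - V x)" by simp
    have s: "dist (V x / V (x/2)) 1 < \<kappa>" "0 < V (x/2)" using d1(2)[of "x/2"] x by auto
    hence "1 - \<kappa> < V x / V (x/2)" by (simp add: dist_real_def)
    hence 2: "(1 - \<kappa>) * V (x/2) < V x" using s by (simp add: field_simps)
    have "(1/2) * V (x/2) \<le> (1 - \<kappa>) * V (x/2)" using \<kappa> s by (intro mult_right_mono) auto
    hence 3: "V (x/2) \<le> 2 * V x" using 2 by simp
    have "\<kappa> * V (x/2) \<le> \<kappa> * (2 * V x)" using 3 \<kappa> by (intro mult_left_mono) auto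
    hence "- x * deriv V x \<le> 4 * \<kappa> * V x" using 1 2 by (simp add: algebra_simps)
    also have "\<dots> \<le> \<eta> * V x" using \<kappa> 3 s by (intro mult_right_mono) auto
    finally show ?thesis .
  qed
  thus ?thesis using d1 d2 by (intro exI[of _ "min d1 d2"]) auto
qed

text \<open>The ratio condition makes \<open>-x\<^sup>2 V'(x)\<close> nondecreasing below the radius.\<close>

lemma deriv_negative_at_radius:
  assumes "smooth_pos V" and S: "convexity_radius V S" and T: "ratio_radius V T"
    and \<rho>: "min T S = ereal \<rho>"
  shows "deriv V \<rho> < 0"
proof -
  define h where "h = (\<lambda>x. - deriv V x * x\<^sup>2)"
  have "0 < ereal \<rho>" unfolding \<rho>[symmetric] using S T by (auto simp: convexity_radius_def ratio_radius_def)
  hence \<rho>0: "0 < \<rho>" by simp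
  have lt: "ereal x < S" "ereal x < T" if "x < \<rho>" for x
  proof -
    have "ereal x < min T S" using that \<rho> by simp
    thus "ereal x < S" "ereal x < T" by auto
  qed
  have dh: "(h has_real_derivative (- deriv (deriv V) x * x\<^sup>2 - 2 * x * deriv V x)) (at x)" if "0 < x" for x
    unfolding h_def using smooth_pos_derivs(2)[OF assms(1) that]
    by (auto intro!: derivative_eq_intros)
  \<comment> \<open>The ratio condition is known strictly below \<open>\<rho>\<close> only. The mean
    value theorem reaches \<open>\<rho>\<close> while using the sign of the derivative of
    \<open>h\<close> at an interior point.\<close>
  have "\<exists>z>\<rho>/2. z < \<rho> \<and> h \<rho> - h (\<rho>/2) = (\<rho> - \<rho>/2) * (- deriv (deriv V) z * z\<^sup>2 - 2 * z * deriv V z)"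
    using \<rho>0 by (intro MVT2 dh) auto
  then obtain z where z: "\<rho>/2 < z" "z < \<rho>"
    "h \<rho> - h (\<rho>/2) = (\<rho> - \<rho>/2) * (- deriv (deriv V) z * z\<^sup>2 - 2 * z * deriv V z)" by blast
  have z0: "0 < z" using z \<rho>0 by simp
  have "deriv V z / deriv (deriv V) z \<le> - z / 2" "0 < deriv (deriv V) z"
    using S T lt[OF z(2)] z0 by (auto simp: convexity_radius_def ratio_radius_def deriv_ratio_def)
  hence "0 \<le> - deriv (deriv V) z * z - 2 * deriv V z" by (simp add: field_simps)
  hence "0 \<le> z * (- deriv (deriv V) z * z - 2 * deriv V z)" using z0 by simp
  hence "0 \<le> (\<rho> - \<rho>/2) * (- deriv (deriv V) z * z\<^sup>2 - 2 * z * deriv V z)"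
    using \<rho>0 by (intro mult_nonneg_nonneg) (auto simp: algebra_simps power2_eq_square)
  moreover have "deriv V (\<rho>/2) < 0" using S lt[of "\<rho>/2"] \<rho>0 by (auto simp: convexity_radius_def)
  hence "0 < h (\<rho>/2)" using \<rho>0 by (simp add: h_def mult_neg_pos)
  ultimately have "0 < h \<rho>" using z by simp
  thus ?thesis using \<rho>0 by (simp add: h_def zero_less_mult_iff mult_less_0_iff)
qed

lemma first_or_infinity_mem:
  assumes "first_or_infinity A = ereal x"
  shows "x \<in> A"
proof -
  obtain r where r: "r \<in> A" "\<forall>s\<in>A. r \<le> s"
    using assms by (auto simp: first_or_infinity_def has_least_def split: if_splits)
  hence "(LEAST r. r \<in> A) = r" by (intro Least_equality) auto
  thus ?thesis using assms r by (auto simp: first_or_infinity_def split: if_splits)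
qed

text \<open>Both normalized cases reduce to one radius \<open>b\<close>: either the radial motion
  cannot reach \<open>b\<close>, or \<open>b\<close> is the boundary of the ball and is crossed at
  positive speed. The margin up to \<open>b1\<close> leaves room for
  \<open>sqrt (r\<^sup>2 + \<epsilon>\<^sup>2)\<close>, which exceeds \<open>r\<close>.\<close>

lemma normalized_radial_endpoint:
  assumes V: "V \<in> class_V" and S: "convexity_radius V S" and T: "ratio_radius V T"
    and R: "R = min T S" and norm: "normalized V R E \<nu>"
  obtains b b1 where "0 < b" "b < b1" "\<And>x. 0 < x \<Longrightarrow> x \<le> b1 \<Longrightarrow> deriv V x < 0"
    "E + V b < 0 \<or> R = ereal b \<and> 0 < E + V b"
proof -
  obtain q p where \<nu>: "\<nu> = (q, p)" by fastforce
  have smooth: "smooth_pos V" using V by (simp add: class_V_def)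
  have R0: "0 < R" using S T R by (auto simp: convexity_radius_def ratio_radius_def)
  have below: "deriv V x < 0" if "0 < x" "ereal x < R" for x
    using S R that by (auto simp: convexity_radius_def)
  have dec: "V y < V x" if "0 < x" "x < y" "\<And>z. x \<le> z \<Longrightarrow> z \<le> y \<Longrightarrow> deriv V z < 0" for x y
  proof (rule DERIV_neg_imp_decreasing[OF that(2)])
    fix z assume "x \<le> z" "z \<le> y"
    thus "\<exists>d. (V has_real_derivative d) (at z) \<and> d < 0"
      using that by (intro exI[of _ "deriv V z"] conjI smooth_pos_derivs(1)[OF smooth]) auto
  qed
  show thesis
  proof (cases "P_first V E < R")
    case True
    then obtain \<rho> where \<rho>: "P_first V E = ereal \<rho>"
      by (cases "P_first V E") (auto simp: P_first_def first_or_infinity_def split: if_splits)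
    hence E: "0 < \<rho>" "f_rad V E \<rho> = 0"
      using first_or_infinity_mem[of _ \<rho>] by (auto simp: P_first_def)
    have \<rho>R: "ereal \<rho> < R" using \<rho> True by simp
    have E: "0 < \<rho>" "E + V \<rho> = 0" using E by (auto simp: f_rad_def)
    \<comment> \<open>Any \<open>b\<close> slightly beyond the turning point \<open>\<rho>\<close>
      works, because \<open>V\<close> is strictly decreasing there.\<close>
    obtain b1 where b1: "ereal \<rho> < ereal b1" "ereal b1 < R" using ereal_dense2[OF \<rho>R] by auto
    obtain b where b: "\<rho> < b" "b < b1" using b1(1) dense[of \<rho> b1] by auto
    have neg: "deriv V x < 0" if "0 < x" "x \<le> b1" for x
      using below[of x] that b1 order_le_less_trans[of "ereal x" "ereal b1" R] by auto
    have "V b < V \<rho>" using E b neg by (intro dec) auto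
    thus thesis using E b neg by (intro that[of b b1]) auto
  next
    case False
    define \<rho> where "\<rho> = norm q"
    have \<rho>: "R = ereal \<rho>" "(norm p)\<^sup>2 = 2 * (E + V \<rho>)"
      using norm False by (auto simp: normalized_def \<nu> \<rho>_def)
    have "0 \<le> 2 * (E + V \<rho>)" unfolding \<rho>(2)[symmetric] by simp
    hence E: "0 \<le> E + V \<rho>" by simp
    have \<rho>0: "0 < \<rho>" using R0 \<rho> by simp
    have "deriv V \<rho> < 0" using deriv_negative_at_radius[OF smooth S T] R \<rho> by simp
    moreover have "isCont (deriv V) \<rho>"
      using smooth_pos_derivs(2)[OF smooth \<rho>0] by (rule DERIV_isCont)
    ultimately have "\<forall>\<^sub>F x in nhds \<rho>. deriv V x < 0"
      by (auto simp: isCont_def tendsto_at_iff_tendsto_nhds intro: order_tendstoD)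
    then obtain d where d: "d > 0" "\<And>x. \<bar>x - \<rho>\<bar> < d \<Longrightarrow> deriv V x < 0"
      by (auto simp: eventually_nhds_metric dist_real_def)
    have neg: "deriv V x < 0" if "0 < x" "x \<le> \<rho> + d / 2" for x
      using below[of x] d(2)[of x] d(1) that \<rho> by (cases "x < \<rho>") auto
    show thesis
    \<comment> \<open>If the turning point lies exactly on the boundary, nearby orbits may turn on
      either side of it. Taking \<open>b\<close> beyond \<open>R\<close> gives the first
      alternative; this relies on \<open>V' < 0\<close> slightly past \<open>R\<close>.\<close>
    proof (cases "E + V \<rho> = 0")
      case True
      have "V (\<rho> + d / 4) < V \<rho>" using \<rho>0 d neg by (intro dec) auto
      thus thesis using True \<rho>0 d neg by (intro that[of "\<rho> + d / 4" "\<rho> + d / 2"]) auto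
    next
      case False
      thus thesis using E \<rho> \<rho>0 d neg by (intro that[of \<rho> "\<rho> + d / 2"]) auto
    qed
  qed
qed

section \<open>The limit along convergent parameters\<close>

text \<open>First the exponent \<open>2 - \<eta>\<close> and the radius \<open>\<delta>\<close> are
  fixed according to the tolerance; then the parameters tend to their limits, and the bounds at
  fixed parameters close in on \<open>pi / 2\<close>.\<close>

lemma apsidal_integral_limit:
  fixes V :: "real \<Rightarrow> real" and eps en am :: "'a \<Rightarrow> real" and E b b1 :: real
  assumes smooth: "smooth_pos V" and top: "filterlim V at_top (at_right 0)"
    and slow: "\<And>\<eta>. 0 < \<eta> \<Longrightarrow> \<exists>d>0. \<forall>x. 0 < x \<longrightarrow> x < d \<longrightarrow> - x * deriv V x \<le> \<eta> * V x"
    and R: "0 < R"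
    and b: "0 < b" "b < b1"
    and neg: "\<And>x. 0 < x \<Longrightarrow> x \<le> b1 \<Longrightarrow> deriv V x < 0"
    and at_b: "E + V b < 0 \<or> R = ereal b \<and> 0 < E + V b"
    and eps: "(eps \<longlongrightarrow> 0) \<Phi>" "\<forall>\<^sub>F z in \<Phi>. 0 < eps z"
    and en: "(en \<longlongrightarrow> E) \<Phi>"
    and am: "(am \<longlongrightarrow> 0) \<Phi>" "\<forall>\<^sub>F z in \<Phi>. 0 < am z"
  shows "((\<lambda>z. apsidal_integral (V_reg V (eps z)) R (en z) (am z)) \<longlongrightarrow> pi / 2) \<Phi>"
proof (rule tendstoI)
  fix \<kappa> :: real assume \<kappa>: "0 < \<kappa>"
  \<comment> \<open>The excess of \<open>pi / (2 - \<eta>)\<close> over \<open>pi / 2\<close> is at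
    most \<open>2 * \<eta>\<close>, hence at most \<open>\<kappa> / 2\<close>; the other half of
    \<open>\<kappa>\<close> is left for the outer part.\<close>
  define \<eta> where "\<eta> = min 1 (\<kappa> / 4)"
  have \<eta>: "0 < \<eta>" "\<eta> \<le> 1" "4 * \<eta> \<le> \<kappa>" using \<kappa> by (auto simp: \<eta>_def)
  have pi_bound: "pi / (2 - \<eta>) \<le> pi / 2 + \<kappa> / 2"
  proof -
    have "pi / (2 - \<eta>) - pi / 2 = pi * \<eta> / (2 * (2 - \<eta>))" using \<eta> by (simp add: field_simps)
    also have "\<dots> \<le> pi * \<eta> / 2" using \<eta> by (intro divide_left_mono) auto
    also have "\<dots> \<le> 4 * \<eta> / 2" using \<eta> pi_less_4 by (intro divide_right_mono mult_right_mono) auto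
    finally show ?thesis using \<eta> by simp
  qed
  obtain d1 where d1: "d1 > 0" "\<And>x. 0 < x \<Longrightarrow> x < d1 \<Longrightarrow> - x * deriv V x \<le> \<eta> / 2 * V x"
    using slow[of "\<eta> / 2"] \<eta> by auto
  \<comment> \<open>The threshold ensures \<open>V x \<le> 2 * (en z + V x)\<close> once
    \<open>\<bar>en z - E\<bar> < 1\<close>. The factor \<open>2\<close> is why the slow variation
    bound was taken with \<open>\<eta> / 2\<close>.\<close>
  have "\<forall>\<^sub>F x in at_right 0. 2 + 2 * \<bar>E\<bar> < V x"
    using top by (simp add: filterlim_at_top_dense)
  then obtain d2 where d2: "d2 > 0" "\<And>x. 0 < x \<Longrightarrow> x < d2 \<Longrightarrow> 2 + 2 * \<bar>E\<bar> < V x"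
    unfolding eventually_at_right_field by auto
  obtain d3 where d3: "0 < ereal d3" "ereal d3 < R" using ereal_dense2[OF R] by auto
  \<comment> \<open>Division by \<open>3\<close> gives room for \<open>2 * \<delta>\<close>, because
    \<open>sqrt (r\<^sup>2 + \<epsilon>\<^sup>2) \<le> r + \<epsilon> < 2 * \<delta>\<close> when
    \<open>r \<le> \<delta>\<close> and \<open>\<epsilon> < \<delta>\<close>.\<close>
  define \<delta> where "\<delta> = Min {d1, d2, d3, b} / 3"
  have \<delta>: "0 < \<delta>" "2 * \<delta> < d1" "2 * \<delta> < d2" "2 * \<delta> < d3" "2 * \<delta> < b"
    using d1 d2 d3 b by (auto simp: \<delta>_def min_def)
  have \<delta>R: "ereal \<delta> < R" using \<delta> d3 by (intro less_trans[of "ereal \<delta>" "ereal d3" R]) auto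
  have "\<exists>x\<in>{\<delta>..b1}. \<forall>y\<in>{\<delta>..b1}. deriv V y \<le> deriv V x"
  proof (rule continuous_attains_sup)
    show "continuous_on {\<delta>..b1} (deriv V)"
      using \<delta> by (intro continuous_at_imp_continuous_on ballI DERIV_isCont[OF smooth_pos_derivs(2)[OF smooth]]) auto
  qed (use \<delta> b in auto)
  then obtain x0 where x0: "x0 \<in> {\<delta>..b1}" "\<And>y. y \<in> {\<delta>..b1} \<Longrightarrow> deriv V y \<le> deriv V x0" by auto
  define c0 where "c0 = - deriv V x0"
  have c0: "0 < c0" using neg[of x0] x0(1) \<delta> by (simp add: c0_def)
  define W where "W = (\<lambda>z. V_reg V (eps z))"
  have W_lim: "((\<lambda>z. W z r) \<longlongrightarrow> V r) \<Phi>" if "0 < r" for r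
  proof -
    have "((\<lambda>z. sqrt (r\<^sup>2 + (eps z)\<^sup>2)) \<longlongrightarrow> sqrt (r\<^sup>2 + 0\<^sup>2)) \<Phi>"
      by (intro tendsto_intros eps)
    hence "((\<lambda>z. sqrt (r\<^sup>2 + (eps z)\<^sup>2)) \<longlongrightarrow> r) \<Phi>" using that by simp
    thus ?thesis unfolding W_def V_reg_def
      by (rule isCont_tendsto_compose[OF DERIV_isCont[OF smooth_pos_derivs(1)[OF smooth that]]])
  qed
  have \<Phi>_lim: "((\<lambda>z. 2 * (en z + W z r) - (am z)\<^sup>2 / r\<^sup>2) \<longlongrightarrow> 2 * (E + V r) - 0\<^sup>2 / r\<^sup>2) \<Phi>" if "0 < r" for r
    using that by (intro tendsto_intros en am W_lim) auto
  have "2 + 2 * \<bar>E\<bar> < V \<delta>" using d2(2)[of \<delta>] \<delta> by simp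
  hence E\<delta>: "0 < E + V \<delta>" by linarith
  have ev_\<delta>: "\<forall>\<^sub>F z in \<Phi>. 0 < 2 * (en z + W z \<delta>) - (am z)\<^sup>2 / \<delta>\<^sup>2"
    using order_tendstoD(1)[OF \<Phi>_lim[OF \<delta>(1)], of 0] E\<delta> by simp
  have ev_b: "\<forall>\<^sub>F z in \<Phi>. 2 * (en z + W z b) - (am z)\<^sup>2 / b\<^sup>2 < 0 \<or>
      R = ereal b \<and> 0 < 2 * (en z + W z b) - (am z)\<^sup>2 / b\<^sup>2"
    using at_b
  proof
    assume "E + V b < 0"
    thus ?thesis using order_tendstoD(2)[OF \<Phi>_lim[OF b(1)], of 0]
      by (auto elim: eventually_mono)
  next
    assume "R = ereal b \<and> 0 < E + V b"
    thus ?thesis using order_tendstoD(1)[OF \<Phi>_lim[OF b(1)], of 0]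
      by (auto elim: eventually_mono)
  qed
  have ev_eps: "\<forall>\<^sub>F z in \<Phi>. eps z < min \<delta> (b1 - b)"
    by (rule order_tendstoD(2)[OF eps(1)]) (use \<delta> b in auto)
  have ev_en: "\<forall>\<^sub>F z in \<Phi>. \<bar>en z - E\<bar> < 1"
    using tendstoD[OF en, of 1] by (simp add: dist_real_def)
  \<comment> \<open>The centrifugal term then uses up at most half of the rate \<open>c0\<close>,
    leaving the decrease rate \<open>c0 / 2\<close> of the radicand.\<close>
  have ev_am: "\<forall>\<^sub>F z in \<Phi>. 4 * (am z)\<^sup>2 < c0 * \<delta> ^ 3"
  proof -
    have "((\<lambda>z. 4 * (am z)\<^sup>2) \<longlongrightarrow> 4 * 0\<^sup>2) \<Phi>" by (intro tendsto_intros am)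
    thus ?thesis by (rule order_tendstoD(2)) (use c0 \<delta> in simp)
  qed
  have ev_upper: "\<forall>\<^sub>F z in \<Phi>. 2 * (am z / (\<delta>\<^sup>2 * sqrt (c0 / 2))) * sqrt b < \<kappa> / 2"
  proof -
    have "((\<lambda>z. 2 * (am z / (\<delta>\<^sup>2 * sqrt (c0 / 2))) * sqrt b) \<longlongrightarrow> 2 * (0 / (\<delta>\<^sup>2 * sqrt (c0 / 2))) * sqrt b) \<Phi>"
      using \<delta> c0 by (intro tendsto_intros am) auto
    thus ?thesis by (rule order_tendstoD(2)) (use \<kappa> in simp)
  qed
  have ev_lower: "\<forall>\<^sub>F z in \<Phi>. pi / 2 - \<kappa> < arctan (sqrt (2 * \<delta>\<^sup>2 * (en z + W z \<delta>) / (am z)\<^sup>2 - 1))"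
  proof -
    have "((\<lambda>z. 2 * \<delta>\<^sup>2 * (en z + W z \<delta>)) \<longlongrightarrow> 2 * \<delta>\<^sup>2 * (E + V \<delta>)) \<Phi>"
      by (intro tendsto_intros en W_lim \<delta>)
    moreover have "((\<lambda>z. (am z)\<^sup>2) \<longlongrightarrow> 0) \<Phi>" using tendsto_power[OF am(1), of 2] by simp
    moreover have "\<forall>\<^sub>F z in \<Phi>. 0 < (am z)\<^sup>2" using am(2) by eventually_elim simp
    moreover have "0 < 2 * \<delta>\<^sup>2 * (E + V \<delta>)" using \<delta> E\<delta> by simp
    ultimately have "filterlim (\<lambda>z. 2 * \<delta>\<^sup>2 * (en z + W z \<delta>) / (am z)\<^sup>2) at_top \<Phi>"
      by (intro LIM_at_top_divide)
    from filterlim_tendsto_add_at_top[OF tendsto_const[of "-1"] this]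
    have "filterlim (\<lambda>z. 2 * \<delta>\<^sup>2 * (en z + W z \<delta>) / (am z)\<^sup>2 - 1) at_top \<Phi>" by simp
    hence "((\<lambda>z. arctan (sqrt (2 * \<delta>\<^sup>2 * (en z + W z \<delta>) / (am z)\<^sup>2 - 1))) \<longlongrightarrow> pi / 2) \<Phi>"
      by (intro filterlim_compose[OF tendsto_arctan_at_top] filterlim_compose[OF sqrt_at_top])
    thus ?thesis using \<kappa> by (intro order_tendstoD(1)) auto
  qed
  show "\<forall>\<^sub>F z in \<Phi>. dist (apsidal_integral (V_reg V (eps z)) R (en z) (am z)) (pi / 2) < \<kappa>"
    using eps(2) am(2) ev_\<delta> ev_b ev_eps ev_en ev_am ev_upper ev_lower
  proof eventually_elim
    case (elim z)
    define \<epsilon> where "\<epsilon> = eps z"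
    define s where "s = (\<lambda>r. sqrt (r\<^sup>2 + \<epsilon>\<^sup>2))"
    define W' where "W' = (\<lambda>r. deriv V (s r) * (r / s r))"
    have \<epsilon>: "0 < \<epsilon>" "\<epsilon> < \<delta>" "\<epsilon> < b1 - b" using elim by (auto simp: \<epsilon>_def)
    have W_eq: "W z r = V (s r)" for r by (simp add: W_def V_reg_def s_def \<epsilon>_def)
    have s_pos: "0 < s r" for r using \<epsilon> by (simp add: s_def add_nonneg_pos)
    have s_ge: "r \<le> s r" for r by (simp add: s_def real_le_rsqrt)
    have s_le: "s r \<le> r + \<epsilon>" if "0 < r" for r
      unfolding s_def using that \<epsilon> by (intro real_le_lsqrt) (auto simp: power2_sum)
    have dW: "(W z has_real_derivative W' r) (at r)" for r
    proof -
      have "(s has_real_derivative r / s r) (at r)"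
        unfolding s_def using s_pos[of r, unfolded s_def]
        by (auto intro!: derivative_eq_intros simp: field_simps)
      from DERIV_chain2[OF smooth_pos_derivs(1)[OF smooth s_pos] this]
      show ?thesis unfolding W'_def W_eq[abs_def] .
    qed
    have cW: "continuous_on {0..} (W z)"
      using dW by (intro continuous_at_imp_continuous_on ballI DERIV_isCont)
    have W'_neg: "W' r \<le> 0" if "0 < r" "r \<le> b" for r
      using neg[OF s_pos, of r] s_le[of r] s_pos[of r] that \<epsilon> unfolding W'_def
      by (intro mult_nonpos_nonneg) auto
    have inner: "0 < en z + W z r" "- (2 - (2 - \<eta>)) * (en z + W z r) \<le> r * W' r"
      if r: "0 < r" "r \<le> \<delta>" for r
    proof -
      have sr: "s r < d1" "s r < d2" "s r \<le> b1" using s_le[OF r(1)] \<epsilon> r \<delta> b by auto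
      have Vs: "2 + 2 * \<bar>E\<bar> < V (s r)" using d2(2)[OF s_pos sr(2)] .
      moreover have "E - 1 < en z" using elim(6) by (simp add: abs_less_iff)
      ultimately have half: "V (s r) \<le> 2 * en z + 2 * W z r" unfolding W_eq by linarith
      show "0 < en z + W z r" using Vs half by linarith
      \<comment> \<open>From \<open>r\<^sup>2 / s r \<le> s r\<close> the bound for \<open>V\<close>
        at \<open>s r\<close> passes to \<open>W\<close> at \<open>r\<close> with the same constant,
        uniformly in \<open>\<epsilon>\<close>.\<close>
      have "r * (r / s r) \<le> s r * 1" using s_ge[of r] s_pos[of r] r by (intro mult_mono) auto
      hence "- deriv V (s r) * (r * (r / s r)) \<le> - deriv V (s r) * s r"
        using neg[OF s_pos sr(3)] by (intro mult_left_mono) auto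
      moreover have "- s r * deriv V (s r) \<le> \<eta> / 2 * V (s r)" using d1(2)[OF s_pos sr(1)] .
      moreover have "\<eta> / 2 * V (s r) \<le> \<eta> / 2 * (2 * (en z + W z r))"
        using half \<eta> by (intro mult_left_mono) auto
      ultimately show "- (2 - (2 - \<eta>)) * (en z + W z r) \<le> r * W' r"
        unfolding W'_def by (simp add: algebra_simps)
    qed
    have outer: "2 * W' r + 2 * (am z)\<^sup>2 / r ^ 3 \<le> - (c0 / 2)" if r: "\<delta> \<le> r" "r \<le> b" for r
    proof -
      have r0: "0 < r" using r \<delta> by simp
      have "s r \<in> {\<delta>..b1}" using s_ge[of r] s_le[OF r0] r \<epsilon> by auto
      hence "c0 \<le> - deriv V (s r)" using x0(2) by (simp add: c0_def)
      moreover have "1 / 2 \<le> r / s r"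
        using s_le[OF r0] s_pos[of r] \<epsilon> r by (simp add: field_simps)
      ultimately have "c0 * (1 / 2) \<le> - deriv V (s r) * (r / s r)"
        using c0 by (intro mult_mono) auto
      hence 1: "2 * W' r \<le> - c0" by (simp add: W'_def)
      have "2 * (am z)\<^sup>2 / r ^ 3 \<le> 2 * (am z)\<^sup>2 / \<delta> ^ 3"
        using r \<delta> by (intro divide_left_mono power_mono) auto
      also have "\<dots> \<le> c0 / 2" using elim(7) \<delta> by (simp add: field_simps)
      finally show ?thesis using 1 by linarith
    qed
    have *: "0 < 2 - \<eta>" "0 < c0 / 2" "\<delta> < b" using \<eta> c0 \<delta> by auto
    note bounds = apsidal_integral_bounds[OF dW cW *(1) elim(2) *(2) \<delta>(1) *(3) \<delta>R inner W'_neg outer elim(3,4)]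
    show ?case
      using bounds elim(8,9) pi_bound unfolding W_def by (simp add: dist_real_def abs_less_iff)
  qed
qed

section \<open>Passage from phase space to energy and angular momentum\<close>

theorem theorem2:
  fixes V :: "real \<Rightarrow> real" and S T R :: ereal and E :: real
    and ubar :: "real \<Rightarrow> real^2" and \<nu>bar :: phase
    and u :: "real \<Rightarrow> phase \<Rightarrow> real \<Rightarrow> real^2"
  assumes "V \<in> class_V_star"
    and "convexity_radius V S" and "ratio_radius V T" and "R = min T S"
    and "collision_solution V ubar" and "energy V (initial ubar) = E"
    and "\<nu>bar = initial ubar" and "normalized V R E \<nu>bar"
    and "\<forall>\<^sub>F (\<epsilon>, \<nu>) in reg_limit \<nu>bar.
           \<exists>a<0. \<exists>b>0. is_solution (V_reg V \<epsilon>) {a<..<b} (u \<epsilon> \<nu>) \<and> initial (u \<epsilon> \<nu>) = \<nu>"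
  shows "((\<lambda>(\<epsilon>, \<nu>). apsidal_angle (V_reg V \<epsilon>) R (u \<epsilon> \<nu>)) \<longlongrightarrow> pi / 2) (reg_limit \<nu>bar)"
proof -
  obtain q p where \<nu>: "\<nu>bar = (q, p)" by fastforce
  have V: "V \<in> class_V" "smooth_pos V" "filterlim V at_top (at_right 0)"
    using assms(1) by (auto simp: class_V_star_def class_V_def)
  have R: "0 < R" using assms(2-4) by (auto simp: convexity_radius_def ratio_radius_def)
  \<comment> \<open>The limit position is away from the origin, so \<open>V\<close> is continuous at
    \<open>norm q\<close> and the regularized energies converge to \<open>E\<close>.\<close>
  have q: "0 < norm q"
  proof (cases "P_first V E < R")
    case True
    then obtain \<rho> where \<rho>: "P_first V E = ereal \<rho>"
      by (cases "P_first V E") (auto simp: P_first_def first_or_infinity_def split: if_splits)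
    hence E: "0 < \<rho>" "f_rad V E \<rho> = 0"
      using first_or_infinity_mem[of _ \<rho>] by (auto simp: P_first_def)
    thus ?thesis using assms(8) \<rho> True by (auto simp: normalized_def \<nu>)
  next
    case False
    thus ?thesis using assms(8) R by (auto simp: normalized_def \<nu>)
  qed
  have l0: "ang_mom (q, p) = 0"
    using assms(8) by (auto simp: normalized_def \<nu> ang_mom_def split: if_splits)
  have E: "energy V (q, p) = E" using assms(6,7) \<nu> by simp
  obtain b b1 where b: "0 < b" "b < b1" "\<And>x. 0 < x \<Longrightarrow> x \<le> b1 \<Longrightarrow> deriv V x < 0"
    "E + V b < 0 \<or> R = ereal b \<and> 0 < E + V b"
    using normalized_radial_endpoint[OF V(1) assms(2-4,8)] by blast
  define \<Phi> where "\<Phi> = reg_limit \<nu>bar"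
  have id: "((\<lambda>z. z) \<longlongrightarrow> (0, q, p)) \<Phi>"
    unfolding \<Phi>_def reg_limit_def \<nu> by (rule tendsto_ident_at)
  have eps: "(fst \<longlongrightarrow> 0) \<Phi>" using tendsto_fst[OF id] by simp
  have qz: "((\<lambda>z. fst (snd z)) \<longlongrightarrow> q) \<Phi>" and pz: "((\<lambda>z. snd (snd z)) \<longlongrightarrow> p) \<Phi>"
    using tendsto_fst[OF tendsto_snd[OF id]] tendsto_snd[OF tendsto_snd[OF id]] by simp_all
  have dom: "\<forall>\<^sub>F z in \<Phi>. 0 < fst z \<and> ang_mom (snd z) \<noteq> 0"
    unfolding \<Phi>_def reg_limit_def eventually_at_filter by (auto intro!: always_eventually)
  have am: "((\<lambda>z. ang_mom (snd z)) \<longlongrightarrow> 0) \<Phi>"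
  proof -
    have "((\<lambda>z. \<bar>fst (snd z) $ 1 * snd (snd z) $ 2 - fst (snd z) $ 2 * snd (snd z) $ 1\<bar>) \<longlongrightarrow>
        \<bar>q $ 1 * p $ 2 - q $ 2 * p $ 1\<bar>) \<Phi>"
      by (intro tendsto_intros qz pz)
    thus ?thesis using l0 by (simp add: ang_mom_def case_prod_unfold)
  qed
  have en: "((\<lambda>z. energy (V_reg V (fst z)) (snd z)) \<longlongrightarrow> E) \<Phi>"
  proof -
    have "((\<lambda>z. sqrt ((norm (fst (snd z)))\<^sup>2 + (fst z)\<^sup>2)) \<longlongrightarrow> sqrt ((norm q)\<^sup>2 + 0\<^sup>2)) \<Phi>"
      by (intro tendsto_intros qz eps)
    hence "((\<lambda>z. sqrt ((norm (fst (snd z)))\<^sup>2 + (fst z)\<^sup>2)) \<longlongrightarrow> norm q) \<Phi>" by simp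
    from isCont_tendsto_compose[OF DERIV_isCont[OF smooth_pos_derivs(1)[OF V(2) q]] this]
    have "((\<lambda>z. (norm (snd (snd z)))\<^sup>2 / 2 - V (sqrt ((norm (fst (snd z)))\<^sup>2 + (fst z)\<^sup>2))) \<longlongrightarrow>
        (norm p)\<^sup>2 / 2 - V (norm q)) \<Phi>"
      by (intro tendsto_intros pz) auto
    thus ?thesis using E by (simp add: energy_def V_reg_def case_prod_unfold)
  qed
  have "((\<lambda>z. apsidal_integral (V_reg V (fst z)) R (energy (V_reg V (fst z)) (snd z)) (ang_mom (snd z)))
      \<longlongrightarrow> pi / 2) \<Phi>"
  proof (rule apsidal_integral_limit[OF V(2,3) class_V_star_log_derivative[OF assms(1,2)] R b eps _ en am])
    show "\<forall>\<^sub>F z in \<Phi>. 0 < fst z" using dom by eventually_elim simp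
    show "\<forall>\<^sub>F z in \<Phi>. 0 < ang_mom (snd z)"
      using dom by eventually_elim (auto simp: ang_mom_def split: prod.splits)
  qed
  \<comment> \<open>Eventually \<open>u \<epsilon> \<nu>\<close> has initial condition
    \<open>\<nu>\<close>, so its energy and angular momentum are those of
    \<open>\<nu>\<close>.\<close>
  moreover have "\<forall>\<^sub>F z in \<Phi>. apsidal_integral (V_reg V (fst z)) R (energy (V_reg V (fst z)) (snd z)) (ang_mom (snd z))
      = (case z of (\<epsilon>, \<nu>) \<Rightarrow> apsidal_angle (V_reg V \<epsilon>) R (u \<epsilon> \<nu>))"
    using assms(9) unfolding \<Phi>_def[symmetric]
    by eventually_elim (auto simp: apsidal_angle_def apsidal_integral_def Let_def)
  ultimately show ?thesis
    unfolding \<Phi>_def[symmetric] by (rule Lim_transform_eventually)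
qed

end
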